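(* For any integers $n,m\ge 1$, the Cartesian product $K_n\,\square\,K_m$ of complete graphs satisfies $$\mathrm{tww}(K_n\,\square\,K_m)=\begin{cases}0 & \text{if } n=m=2 \text{ or } \min\{n,m\}=1,\\ 2(\min\{n,m\}-1) & \text{otherwise.}\end{cases}$$
   Context: All graphs are finite and simple (no loops or multiple edges). $K_n$ is the complete graph on $n$ vertices. Twin-width. A trigraph $G$ has a vertex set $V(G)$, a set $E(G)$ of black edges and a set $R(G)$ of red edges, with $E(G)\cap R(G)=\emptyset$; a graph is a trigraph with no red edges. $N_G(v)$ is the set of vertices joined to $v$ by a black or red edge. A $d$-trigraph is a trigraph in which every vertex is incident with at most $d$ red edges. A contraction merges two distinct (not necessarily adjacent) vertices $u,v$ into a new vertex $w$: every vertex other than $u,v$ in $N_G(u)\triangle N_G(v)$ is joined to $w$ by a red edge; every $x\in N_G(u)\cap N_G(v)$ is joined to $w$ by a black edge if $ux,vx\in E(G)$ and by a red edge otherwise; all edges not incident with $u$ or $v$ are unchanged, and $u,v$ and their incident edges are removed. A $d$-sequence of an $n$-vertex graph $G$ is a sequence of $d$-trigraphs $G_n=G,G_{n-1},\dots,G_1=K_1$ with each $G_{i-1}$ obtained from $G_i$ by one contraction. The twin-width $\mathrm{tww}(G)$ is the least $d$ such that $G$ admits a $d$-sequence. Cartesian product. $G\,\square\,H$ has vertex set $V(G)\times V(H)$, and $(u,i)(v,j)$ is an edge iff [$u=v$ and $ij\in E(H)$] or [$i=j$ and $uv\in E(G)$]. *)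

theory Defs
  imports Main
begin

section \<open>Finite simple graphs\<close>

record 'a graph =
  verts :: "'a set"
  edges :: "'a set set"

definition simple_graph :: "'a graph \<Rightarrow> bool" where
  "simple_graph G \<longleftrightarrow> finite (verts G) \<and> (\<forall>e\<in>edges G. e \<subseteq> verts G \<and> card e = 2)"

definition complete_graph :: "nat \<Rightarrow> nat graph" where
  "complete_graph n = \<lparr>verts = {..<n}, edges = {e. e \<subseteq> {..<n} \<and> card e = 2}\<rparr>"

definition cartesian_product :: "'a graph \<Rightarrow> 'b graph \<Rightarrow> ('a \<times> 'b) graph" where
  "cartesian_product G H =
     \<lparr>verts = verts G \<times> verts H,
      edges = {{(u, i), (v, j)} | u i v j.
                 u \<in> verts G \<and> v \<in> verts G \<and> i \<in> verts H \<and> j \<in> verts H \<and>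
                 (u = v \<and> {i, j} \<in> edges H \<or> i = j \<and> {u, v} \<in> edges G)}\<rparr>"

lemma simple_graph_complete_graph: "simple_graph (complete_graph n)"
  by (auto simp: simple_graph_def complete_graph_def)
lemma simple_graph_cartesian_product:
  assumes G: "simple_graph G" and H: "simple_graph H"
  shows "simple_graph (cartesian_product G H)"
proof -
  have A: "card {a,b} = 2" if "{a,b} \<in> edges G" for a b using G that by (auto simp: simple_graph_def)
  have B: "card {a,b} = 2" if "{a,b} \<in> edges H" for a b using H that by (auto simp: simple_graph_def)
  have A': "a \<noteq> b" if "{a,b} \<in> edges G" for a b using A[OF that] by auto
  have B': "a \<noteq> b" if "{a,b} \<in> edges H" for a b using B[OF that] by auto
  show ?thesis using G H by (auto simp: simple_graph_def cartesian_product_def card_insert_if dest: A' B')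
qed

section \<open>Trigraphs and contractions\<close>

record 'a trigraph =
  tverts :: "'a set"
  black :: "'a set set"
  red :: "'a set set"

definition trigraph :: "'a trigraph \<Rightarrow> bool" where
  "trigraph T \<longleftrightarrow> finite (tverts T) \<and>
     (\<forall>e \<in> black T \<union> red T. e \<subseteq> tverts T \<and> card e = 2) \<and> black T \<inter> red T = {}"

definition trigraph_of :: "'a graph \<Rightarrow> 'a trigraph" where
  "trigraph_of G = \<lparr>tverts = verts G, black = edges G, red = {}\<rparr>"

definition nbrs :: "'a trigraph \<Rightarrow> 'a \<Rightarrow> 'a set" where
  "nbrs T v = {x. {v, x} \<in> black T \<union> red T}"

definition d_trigraph :: "nat \<Rightarrow> 'a trigraph \<Rightarrow> bool" where
  "d_trigraph d T \<longleftrightarrow> trigraph T \<and> (\<forall>v \<in> tverts T. card {e \<in> red T. v \<in> e} \<le> d)"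

definition contract :: "'a trigraph \<Rightarrow> 'a \<Rightarrow> 'a \<Rightarrow> 'a \<Rightarrow> 'a trigraph" where
  "contract T u v w =
    (let symdiff = (nbrs T u - nbrs T v) \<union> (nbrs T v - nbrs T u) - {u, v};
         common = nbrs T u \<inter> nbrs T v;
         both_black = {x. {u, x} \<in> black T \<and> {v, x} \<in> black T}
     in \<lparr>tverts = insert w (tverts T - {u, v}),
         black = {e \<in> black T. u \<notin> e \<and> v \<notin> e} \<union> {{w, x} | x. x \<in> common \<inter> both_black},
         red = {e \<in> red T. u \<notin> e \<and> v \<notin> e} \<union> {{w, x} | x. x \<in> symdiff \<union> (common - both_black)}\<rparr>)"

text \<open>
  The merged vertex may carry any name that does not clash with a surviving vertex; in
  particular it may reuse the name of one of the two vertices that disappear. Names are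
  irrelevant to the width, and this keeps contractions available over finite vertex types.
\<close>

definition contracts_to :: "'a trigraph \<Rightarrow> 'a trigraph \<Rightarrow> bool" where
  "contracts_to T T' \<longleftrightarrow>
     (\<exists>u v w. u \<in> tverts T \<and> v \<in> tverts T \<and> u \<noteq> v \<and> w \<notin> tverts T - {u, v} \<and>
              T' = contract T u v w)"

lemma trigraph_contract:
  assumes T: "trigraph T"
    and uv: "u\<in>tverts T" "v\<in>tverts T" "u\<noteq>v"
    and w: "w \<notin> tverts T - {u,v}"
  shows "trigraph (contract T u v w)"
proof -
  have S: "e \<subseteq> tverts T" "card e = 2" if "e \<in> black T \<or> e \<in> red T" for e
    using T that unfolding trigraph_def by auto
  have V: "x \<in> tverts T" "a \<in> tverts T" "a \<noteq> x" if "{a,x} \<in> black T \<or> {a,x} \<in> red T" for a x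
    using S[OF that] by auto
  have D: "e \<in> black T \<Longrightarrow> e \<notin> red T" for e using T unfolding trigraph_def by auto
  have X: "x \<in> tverts T - {u,v}" "x \<noteq> w" if "x \<in> nbrs T u \<or> x \<in> nbrs T v" "x \<notin> {u,v}" for x
    using that V w unfolding nbrs_def by blast+
  have C: "x \<notin> {u,v}" if "x \<in> nbrs T u \<inter> nbrs T v" for x
    using that V unfolding nbrs_def by blast
  have F: "w \<notin> e" if "e \<in> black T \<or> e \<in> red T" "u \<notin> e" "v \<notin> e" for e
    using S(1)[OF that(1)] that w by blast
  have 1: "finite (tverts (contract T u v w))" using T by (simp add: trigraph_def contract_def Let_def)
  have 2: "e \<subseteq> tverts (contract T u v w) \<and> card e = 2" if mm: "e \<in> black (contract T u v w) \<union> red (contract T u v w)" for e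
  proof -
    consider (a) "e \<in> black T \<or> e \<in> red T" "u \<notin> e" "v \<notin> e" | (b) x where "e = {w,x}" "x \<in> nbrs T u \<or> x \<in> nbrs T v" "x \<notin> {u,v}"
    proof -
      have "((e \<in> black T \<or> e \<in> red T) \<and> u \<notin> e \<and> v \<notin> e) \<or> (\<exists>x. e = {w,x} \<and> (x \<in> nbrs T u \<or> x \<in> nbrs T v) \<and> x \<notin> {u,v})"
        using mm C unfolding contract_def Let_def by simp blast
      then show ?thesis using that by blast
    qed
    then show ?thesis using S X by cases (auto simp: contract_def Let_def card_insert_if, blast+)
  qed
  have 3: "black (contract T u v w) \<inter> red (contract T u v w) = {}"
    using D F X C by (auto simp: contract_def Let_def doubleton_eq_iff)
  show ?thesis using 1 2 3 by (auto simp: trigraph_def)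
qed

section \<open>Twin-width\<close>

text \<open>
  \<open>S i\<close> is the trigraph \<open>G\<^sub>i\<close> with \<open>i\<close> vertices; values of \<open>S\<close> outside \<open>{1..card (verts G)}\<close>
  are irrelevant for nonempty \<open>G\<close>.
\<close>

definition d_sequence :: "nat \<Rightarrow> 'a graph \<Rightarrow> (nat \<Rightarrow> 'a trigraph) \<Rightarrow> bool" where
  "d_sequence d G S \<longleftrightarrow>
     S (card (verts G)) = trigraph_of G \<and>
     (\<forall>i \<in> {1..card (verts G)}. d_trigraph d (S i)) \<and>
     (\<forall>i \<in> {2..card (verts G)}. contracts_to (S i) (S (i - 1))) \<and>
     (\<exists>x. S 1 = \<lparr>tverts = {x}, black = {}, red = {}\<rparr>)"

definition tww :: "'a graph \<Rightarrow> nat" where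
  "tww G = (LEAST d. \<exists>S. d_sequence d G S)"

end

theory Submission
  imports Defs
begin

text \<open>
  A contraction sequence is a chain of ever coarser partitions of the vertex set; the trigraphs
  are the quotients, where two parts are joined by a red edge iff some but not all pairs between
  them are adjacent. For the upper bound, the columns are merged one after the other, row by row,
  into one fixed column: red edges then only join different rows inside two columns. For the
  lower bound the first contraction suffices: except in the 4-cycle, no two vertices are closer
  to being twins than two in a common row or column.
\<close>

section \<open>Trigraphs as quotients of a graph by a vertex map\<close>

definition full_between :: "'b graph \<Rightarrow> ('b \<Rightarrow> 'a) \<Rightarrow> 'a \<Rightarrow> 'a \<Rightarrow> bool" where
  "full_between H f x y \<longleftrightarrow>
     (\<forall>v\<in>verts H. \<forall>w\<in>verts H. f v = x \<longrightarrow> f w = y \<longrightarrow> {v, w} \<in> edges H)"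

definition some_between :: "'b graph \<Rightarrow> ('b \<Rightarrow> 'a) \<Rightarrow> 'a \<Rightarrow> 'a \<Rightarrow> bool" where
  "some_between H f x y \<longleftrightarrow>
     (\<exists>v\<in>verts H. \<exists>w\<in>verts H. f v = x \<and> f w = y \<and> {v, w} \<in> edges H)"

text \<open>The parts are the fibres of \<open>f\<close>, each named by its value.
  \<open>full_between\<close> is vacuous for a value outside the image, hence the membership
  conditions on black edges; for red edges \<open>some_between\<close> already forces both fibres to
  be nonempty.\<close>

definition quotient_trigraph :: "'b graph \<Rightarrow> ('b \<Rightarrow> 'a) \<Rightarrow> 'a trigraph" where
  "quotient_trigraph H f =
     \<lparr>tverts = f ` verts H,
      black = {{x, y} | x y. x \<in> f ` verts H \<and> y \<in> f ` verts H \<and> x \<noteq> y \<and> full_between H f x y},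
      red = {{x, y} | x y. x \<noteq> y \<and> some_between H f x y \<and> \<not> full_between H f x y}\<rparr>"

lemma full_between_commute: "full_between H f x y \<longleftrightarrow> full_between H f y x"
proof -
  have "full_between H f b a" if "full_between H f a b" for a b
    unfolding full_between_def
  proof (intro ballI impI)
    fix v w assume "v \<in> verts H" "w \<in> verts H" "f v = b" "f w = a"
    then have "{w, v} \<in> edges H"
      using that by (simp add: full_between_def)
    then show "{v, w} \<in> edges H"
      by (simp add: insert_commute)
  qed
  then show ?thesis
    by blast
qed

lemma some_between_commute: "some_between H f x y \<longleftrightarrow> some_between H f y x"
proof -
  have "some_between H f b a" if ab: "some_between H f a b" for a b
  proof -
    obtain v w where "v \<in> verts H" "w \<in> verts H" "f v = a" "f w = b" "{v, w} \<in> edges H"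
      using ab unfolding some_between_def by blast
    moreover from this have "{w, v} \<in> edges H"
      by (simp add: insert_commute)
    ultimately show ?thesis
      unfolding some_between_def by blast
  qed
  then show ?thesis
    by blast
qed

lemma tverts_quotient [simp]: "tverts (quotient_trigraph H f) = f ` verts H"
  by (simp add: quotient_trigraph_def)

lemma black_quotient_iff:
  "{x, y} \<in> black (quotient_trigraph H f) \<longleftrightarrow>
     x \<in> f ` verts H \<and> y \<in> f ` verts H \<and> x \<noteq> y \<and> full_between H f x y"
  using full_between_commute[of H f]
  by (auto simp: quotient_trigraph_def doubleton_eq_iff)

lemma red_quotient_iff:
  "{x, y} \<in> red (quotient_trigraph H f) \<longleftrightarrow>
     x \<noteq> y \<and> some_between H f x y \<and> \<not> full_between H f x y"
  using full_between_commute[of H f] some_between_commute[of H f]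
  by (auto simp: quotient_trigraph_def doubleton_eq_iff)

lemma some_between_image: "some_between H f x y \<Longrightarrow> x \<in> f ` verts H \<and> y \<in> f ` verts H"
  by (auto simp: some_between_def)

lemma full_imp_some_between:
  "full_between H f x y \<Longrightarrow> x \<in> f ` verts H \<Longrightarrow> y \<in> f ` verts H \<Longrightarrow> some_between H f x y"
  unfolding full_between_def some_between_def by (elim imageE) blast

text \<open>On nonempty fibres full adjacency implies some adjacency, so forgetting colours leaves
  only \<open>some_between\<close>.\<close>

lemma nbrs_quotient:
  "nbrs (quotient_trigraph H f) x = {y. x \<noteq> y \<and> some_between H f x y}"
  using full_imp_some_between[of H f x] some_between_image[of H f x]
  by (auto simp: nbrs_def black_quotient_iff red_quotient_iff)

lemma trigraph_quotient:
  assumes "finite (verts H)"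
  shows "trigraph (quotient_trigraph H f)"
proof -
  have "e \<subseteq> f ` verts H \<and> card e = 2"
    if "e \<in> black (quotient_trigraph H f) \<union> red (quotient_trigraph H f)" for e
    using that some_between_image[of H f] by (fastforce simp: quotient_trigraph_def)
  moreover have "e \<notin> red (quotient_trigraph H f)" if e: "e \<in> black (quotient_trigraph H f)" for e
  proof -
    obtain x y where "e = {x, y}"
      using e by (auto simp: quotient_trigraph_def)
    then show ?thesis
      using e by (simp add: black_quotient_iff red_quotient_iff)
  qed
  ultimately show ?thesis
    using assms by (auto simp: trigraph_def)
qed

text \<open>Reduces equality of edge sets to membership of pairs, the form in which
  \<open>black_quotient_iff\<close> and \<open>red_quotient_iff\<close> apply.\<close>

lemma doubleton_sets_eqI:
  assumes "\<And>e. e \<in> A \<Longrightarrow> \<exists>x y. e = {x, y}" "\<And>e. e \<in> B \<Longrightarrow> \<exists>x y. e = {x, y}"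
    and "\<And>x y. {x, y} \<in> A \<longleftrightarrow> {x, y} \<in> B"
  shows "A = B"
  using assms by (metis subsetI subset_antisym)

lemma doubleton_mem_star_iff:
  "{x, y} \<in> {{u, z} | z. z \<in> A} \<longleftrightarrow> x = u \<and> y \<in> A \<or> y = u \<and> x \<in> A"
  by (auto simp: doubleton_eq_iff)

text \<open>The new fibre of \<open>u\<close> is the union of the old fibres of \<open>u\<close> and
  \<open>v\<close>. It is fully joined to another part iff both old fibres are, and joined at all
  iff one of them is; this is the colour rule of a contraction. Reusing the name \<open>u\<close>
  avoids any need for a fresh element of the type.\<close>

lemma contract_quotient:
  fixes f :: "'b \<Rightarrow> 'a"
  assumes u: "u \<in> f ` verts H" and v: "v \<in> f ` verts H" and uv: "u \<noteq> v"
  shows "contract (quotient_trigraph H f) u v u =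
           quotient_trigraph H (\<lambda>z. if f z = v then u else f z)"
    (is "contract ?Q u v u = quotient_trigraph H ?f")
proof -
  have im: "?f ` verts H = f ` verts H - {v}"
    using u uv by auto
  have val_other: "?f z = x \<longleftrightarrow> f z = x" if "x \<notin> {u, v}" for x z
    using that by auto
  have val_u: "?f z = u \<longleftrightarrow> f z = u \<or> f z = v" and val_v: "?f z \<noteq> v" for z
    using uv by simp_all
  have full_other: "full_between H ?f x y \<longleftrightarrow> full_between H f x y"
    if "x \<notin> {u, v}" "y \<notin> {u, v}" for x y
    unfolding full_between_def by (simp only: val_other[OF that(1)] val_other[OF that(2)])
  have some_other: "some_between H ?f x y \<longleftrightarrow> some_between H f x y"
    if "x \<notin> {u, v}" "y \<notin> {u, v}" for x y
    unfolding some_between_def by (simp only: val_other[OF that(1)] val_other[OF that(2)])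
  have full_u: "full_between H ?f u y \<longleftrightarrow> full_between H f u y \<and> full_between H f v y"
    if "y \<notin> {u, v}" for y
    unfolding full_between_def by (simp only: val_other[OF that] val_u) blast
  have some_u: "some_between H ?f u y \<longleftrightarrow> some_between H f u y \<or> some_between H f v y"
    if "y \<notin> {u, v}" for y
    unfolding some_between_def by (simp only: val_other[OF that] val_u) blast
  have no_v: "\<not> some_between H ?f v y" "\<not> some_between H ?f y v" for y
    unfolding some_between_def using val_v by simp_all
  have im_some: "some_between H f p x \<longrightarrow> x \<in> f ` verts H"
    and full_some: "p \<in> f ` verts H \<longrightarrow> x \<in> f ` verts H \<longrightarrow> full_between H f p x \<longrightarrow> some_between H f p x" for p x
    using some_between_image full_imp_some_between by metis+
  \<comment> \<open>The ends of the new black edges. Membership in \<open>nbrs\<close> is absorbed,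
    since full implies some for values in the image.\<close>
  have bl_set: "nbrs ?Q u \<inter> nbrs ?Q v \<inter> {x. {u, x} \<in> black ?Q \<and> {v, x} \<in> black ?Q} =
      {x. x \<notin> {u, v} \<and> x \<in> f ` verts H \<and> full_between H f u x \<and> full_between H f v x}" (is "?B = ?B'")
  proof (rule set_eqI)
    show "x \<in> ?B \<longleftrightarrow> x \<in> ?B'" for x
      unfolding nbrs_quotient black_quotient_iff
      using u v full_some[of u x] full_some[of v x]
      by (simp only: Int_iff insert_iff empty_iff mem_Collect_eq) argo
  qed
  \<comment> \<open>The ends of the new red edges. A vertex adjacent to only one of
    \<open>u\<close>, \<open>v\<close> is not fully joined to the other, so both kinds of red edge
    fall under one condition.\<close>
  have rd_set: "((nbrs ?Q u - nbrs ?Q v) \<union> (nbrs ?Q v - nbrs ?Q u) - {u, v}) \<union>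
       (nbrs ?Q u \<inter> nbrs ?Q v - {x. {u, x} \<in> black ?Q \<and> {v, x} \<in> black ?Q}) =
      {x. x \<notin> {u, v} \<and> (some_between H f u x \<or> some_between H f v x) \<and>
          \<not> (full_between H f u x \<and> full_between H f v x)}" (is "?R = ?R'")
  proof (rule set_eqI)
    show "x \<in> ?R \<longleftrightarrow> x \<in> ?R'" for x
      unfolding nbrs_quotient black_quotient_iff
        Un_iff Int_iff Diff_iff insert_iff empty_iff mem_Collect_eq
      using u v full_some[of u x] full_some[of v x] im_some[of u x] im_some[of v x]
      by argo
  qed
  have bl: "{x, y} \<in> black (contract ?Q u v u) \<longleftrightarrow>
      ({x, y} \<in> black ?Q \<and> x \<notin> {u, v} \<and> y \<notin> {u, v}) \<or>
      (x = u \<and> y \<notin> {u, v} \<and> y \<in> f ` verts H \<and> full_between H f u y \<and> full_between H f v y) \<or>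
      (y = u \<and> x \<notin> {u, v} \<and> x \<in> f ` verts H \<and> full_between H f u x \<and> full_between H f v x)" for x y
    unfolding contract_def Let_def trigraph.select_convs bl_set Un_iff doubleton_mem_star_iff by auto
  have rd: "{x, y} \<in> red (contract ?Q u v u) \<longleftrightarrow>
      ({x, y} \<in> red ?Q \<and> x \<notin> {u, v} \<and> y \<notin> {u, v}) \<or>
      (x = u \<and> y \<notin> {u, v} \<and> (some_between H f u y \<or> some_between H f v y) \<and>
         \<not> (full_between H f u y \<and> full_between H f v y)) \<or>
      (y = u \<and> x \<notin> {u, v} \<and> (some_between H f u x \<or> some_between H f v x) \<and>
         \<not> (full_between H f u x \<and> full_between H f v x))" for x y
    unfolding contract_def Let_def trigraph.select_convs rd_set
      Un_iff[of "{x, y}"] doubleton_mem_star_iff by auto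
  have "black (contract ?Q u v u) = black (quotient_trigraph H ?f)"
  proof (rule doubleton_sets_eqI)
    show "{x, y} \<in> black (contract ?Q u v u) \<longleftrightarrow> {x, y} \<in> black (quotient_trigraph H ?f)" for x y
      unfolding bl black_quotient_iff im
      using full_other[of x y] full_u[of x] full_u[of y] full_between_commute[of H ?f x u] u uv
      by (cases "x = u"; cases "y = u"; cases "x = v"; cases "y = v") auto
  qed (auto simp: contract_def Let_def quotient_trigraph_def)
  moreover have "red (contract ?Q u v u) = red (quotient_trigraph H ?f)"
  proof (rule doubleton_sets_eqI)
    show "{x, y} \<in> red (contract ?Q u v u) \<longleftrightarrow> {x, y} \<in> red (quotient_trigraph H ?f)" for x y
      unfolding rd red_quotient_iff
      using full_other[of x y] full_u[of x] full_u[of y] full_between_commute[of H ?f x u]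
        some_other[of x y] some_u[of x] some_u[of y] some_between_commute[of H ?f x u]
        no_v u uv
      by (cases "x = u"; cases "y = u"; cases "x = v"; cases "y = v") auto
  qed (auto simp: contract_def Let_def quotient_trigraph_def)
  moreover have "tverts (contract ?Q u v u) = tverts (quotient_trigraph H ?f)"
    using u uv im by (auto simp: contract_def Let_def)
  ultimately show ?thesis
    by simp
qed

section \<open>Red degrees, and contraction sequences from chains of maps\<close>

definition mixed :: "'b graph \<Rightarrow> ('b \<Rightarrow> 'a) \<Rightarrow> 'a \<Rightarrow> 'a \<Rightarrow> bool" where
  "mixed H f x y \<longleftrightarrow> x \<noteq> y \<and> some_between H f x y \<and> \<not> full_between H f x y"

lemma mixed_inj_comp:
  assumes "inj \<sigma>"
  shows "mixed H (\<lambda>z. \<sigma> (h z)) (\<sigma> x) (\<sigma> y) \<longleftrightarrow> mixed H h x y"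
  using assms by (auto simp: mixed_def full_between_def some_between_def inj_eq)

lemma mixed_image: "mixed H f x y \<Longrightarrow> y \<in> f ` verts H"
  by (auto simp: mixed_def some_between_def)

text \<open>Red edges at \<open>\<sigma> x\<close> arise from the values \<open>y\<close> mixed with
  \<open>x\<close>, so the degree can be bounded before renaming by \<open>\<sigma>\<close>.\<close>

lemma d_trigraph_quotient:
  assumes fin: "finite (verts H)" and \<sigma>: "inj \<sigma>"
    and deg: "\<And>x. x \<in> h ` verts H \<Longrightarrow> card {y. mixed H h x y} \<le> d"
  shows "d_trigraph d (quotient_trigraph H (\<lambda>z. \<sigma> (h z)))"
proof -
  let ?Q = "quotient_trigraph H (\<lambda>z. \<sigma> (h z))"
  have "card {e \<in> red ?Q. p \<in> e} \<le> d" if p: "p \<in> tverts ?Q" for p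
  proof -
    obtain x where x: "x \<in> h ` verts H" "p = \<sigma> x"
      using p by auto
    have finx: "finite {y. mixed H h x y}"
      by (rule finite_subset[of _ "h ` verts H"]) (use fin mixed_image in fastforce)+
    have "{e \<in> red ?Q. p \<in> e} \<subseteq> (\<lambda>y. {p, \<sigma> y}) ` {y. mixed H h x y}"
    proof
      fix e assume e: "e \<in> {e \<in> red ?Q. p \<in> e}"
      then obtain q where eq: "e = {p, q}"
        by (auto simp: quotient_trigraph_def)
      then have m: "mixed H (\<lambda>z. \<sigma> (h z)) p q"
        using e by (simp add: red_quotient_iff mixed_def)
      then obtain y where y: "q = \<sigma> y"
        using mixed_image by fastforce
      with m have "mixed H h x y"
        using mixed_inj_comp[OF \<sigma>] x by metis
      then show "e \<in> (\<lambda>y. {p, \<sigma> y}) ` {y. mixed H h x y}"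
        using eq y by blast
    qed
    then have "card {e \<in> red ?Q. p \<in> e} \<le> card {y. mixed H h x y}"
      using finx by (meson card_image_le card_mono finite_imageI le_trans)
    then show ?thesis
      using deg[OF x(1)] by linarith
  qed
  then show ?thesis
    using fin by (simp add: d_trigraph_def trigraph_quotient)
qed

lemma quotient_trigraph_cong:
  assumes "\<And>z. z \<in> verts H \<Longrightarrow> f z = g z"
  shows "quotient_trigraph H f = quotient_trigraph H g"
proof -
  have "full_between H f = full_between H g" "some_between H f = some_between H g"
    using assms by (auto simp: fun_eq_iff full_between_def some_between_def)
  moreover have "f ` verts H = g ` verts H"
    using assms by (rule image_cong[OF refl])
  ultimately show ?thesis
    unfolding quotient_trigraph_def by simp
qed

text \<open>With fibres of at most one vertex, \<open>some_between\<close> implies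
  \<open>full_between\<close>, so no red edge occurs: this is the start of the sequence.\<close>

lemma quotient_trigraph_inj:
  assumes H: "simple_graph H" and \<sigma>: "inj \<sigma>"
  shows "quotient_trigraph H \<sigma> = trigraph_of \<lparr>verts = \<sigma> ` verts H, edges = (`) \<sigma> ` edges H\<rparr>"
proof -
  have S: "e \<subseteq> verts H" "card e = 2" if "e \<in> edges H" for e
    using H that by (auto simp: simple_graph_def)
  have "red (quotient_trigraph H \<sigma>) = {}"
    using \<sigma> by (auto simp: quotient_trigraph_def full_between_def some_between_def inj_eq)
  moreover have "e \<in> (`) \<sigma> ` edges H" if e: "e \<in> black (quotient_trigraph H \<sigma>)" for e
  proof -
    obtain v w where vw: "e = {\<sigma> v, \<sigma> w}" "{v, w} \<in> edges H"
      using e by (simp add: quotient_trigraph_def full_between_def) blast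
    then have "e = \<sigma> ` {v, w}" by simp
    then show ?thesis using vw by blast
  qed
  moreover have "\<sigma> ` e \<in> black (quotient_trigraph H \<sigma>)" if e: "e \<in> edges H" for e
  proof -
    obtain v w where vw: "e = {v, w}" "v \<noteq> w"
      using S(2)[OF e] by (auto simp: card_2_iff)
    have "{\<sigma> v, \<sigma> w} \<in> black (quotient_trigraph H \<sigma>)"
      unfolding black_quotient_iff
      using vw e S(1)[OF e] \<sigma> by (auto simp: full_between_def inj_eq)
    then show ?thesis using vw by simp
  qed
  ultimately have "black (quotient_trigraph H \<sigma>) = (`) \<sigma> ` edges H"
    "red (quotient_trigraph H \<sigma>) = {}"
    by blast+
  then show ?thesis
    by (simp add: trigraph_of_def)
qed

text \<open>The fibres of \<open>h k\<close> are the parts of the \<open>k\<close>-th trigraph, and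
  each step identifies one value \<open>v\<close> with another value \<open>u\<close>, which is a
  contraction by \<open>contract_quotient\<close>. The renaming \<open>\<sigma>\<close> carries a
  sequence over to an isomorphic graph, such as the transposed product.\<close>

lemma d_sequence_of_maps:
  fixes H :: "'b graph" and \<sigma> :: "'b \<Rightarrow> 'a" and h :: "nat \<Rightarrow> 'b \<Rightarrow> 'b"
  defines "N \<equiv> card (verts H)"
  assumes H: "simple_graph H" and \<sigma>: "inj \<sigma>"
    and init: "\<And>z. z \<in> verts H \<Longrightarrow> h N z = z"
    and step: "\<And>k. 1 \<le> k \<Longrightarrow> k < N \<Longrightarrow> \<exists>u\<in>h (Suc k) ` verts H. \<exists>v\<in>h (Suc k) ` verts H. u \<noteq> v \<and>
                 (\<forall>z\<in>verts H. h k z = (if h (Suc k) z = v then u else h (Suc k) z))"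
    and last: "\<And>z. z \<in> verts H \<Longrightarrow> h 1 z = r"
    and ne: "verts H \<noteq> {}"
    and deg: "\<And>k x. 1 \<le> k \<Longrightarrow> k \<le> N \<Longrightarrow> x \<in> h k ` verts H \<Longrightarrow> card {y. mixed H (h k) x y} \<le> d"
  shows "\<exists>S. d_sequence d \<lparr>verts = \<sigma> ` verts H, edges = (`) \<sigma> ` edges H\<rparr> S"
proof -
  let ?G = "\<lparr>verts = \<sigma> ` verts H, edges = (`) \<sigma> ` edges H\<rparr>"
  let ?S = "\<lambda>k. quotient_trigraph H (\<lambda>z. \<sigma> (h k z))"
  have fin: "finite (verts H)"
    using H by (simp add: simple_graph_def)
  have N: "card (verts ?G) = N"
    using \<sigma> by (simp add: N_def card_image inj_on_subset)
  have "?S N = quotient_trigraph H \<sigma>"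
    using init by (intro quotient_trigraph_cong) simp
  then have S_init: "?S N = trigraph_of ?G"
    using quotient_trigraph_inj[OF H \<sigma>] by simp
  have S_step: "contracts_to (?S i) (?S (i - 1))" if i: "i \<in> {2..N}" for i
  proof -
    obtain k where k: "i = Suc k" "1 \<le> k" "k < N"
      using i by (cases i) auto
    obtain u v where uv: "u \<in> h i ` verts H" "v \<in> h i ` verts H" "u \<noteq> v"
      and hk: "\<forall>z\<in>verts H. h k z = (if h i z = v then u else h i z)"
      using step[OF k(2,3)] k(1) by blast
    have uv': "\<sigma> u \<in> (\<lambda>z. \<sigma> (h i z)) ` verts H" "\<sigma> v \<in> (\<lambda>z. \<sigma> (h i z)) ` verts H" "\<sigma> u \<noteq> \<sigma> v"
      using uv \<sigma> by (auto simp: inj_eq)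
    have "?S (i - 1) = quotient_trigraph H (\<lambda>z. if \<sigma> (h i z) = \<sigma> v then \<sigma> u else \<sigma> (h i z))"
      using hk k \<sigma> by (intro quotient_trigraph_cong) (auto simp: inj_eq)
    also have "\<dots> = contract (?S i) (\<sigma> u) (\<sigma> v) (\<sigma> u)"
      using contract_quotient[OF uv'] by simp
    finally show ?thesis
      unfolding contracts_to_def using uv' by (intro exI[of _ "\<sigma> u"] exI[of _ "\<sigma> v"]) auto
  qed
  have "?S 1 = quotient_trigraph H (\<lambda>_. \<sigma> r)"
    using last by (intro quotient_trigraph_cong) simp
  also have "\<dots> = \<lparr>tverts = {\<sigma> r}, black = {}, red = {}\<rparr>"
    using ne by (auto simp: quotient_trigraph_def some_between_def)
  finally have "d_sequence d ?G ?S"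
    unfolding d_sequence_def N
    using S_init S_step d_trigraph_quotient[OF fin \<sigma> deg] by auto
  then show ?thesis
    by blast
qed

section \<open>Products of complete graphs and upper bounds for their twin-width\<close>

abbreviation rook :: "nat \<Rightarrow> nat \<Rightarrow> (nat \<times> nat) graph" where
  "rook n m \<equiv> cartesian_product (complete_graph n) (complete_graph m)"

lemma verts_rook [simp]: "verts (rook n m) = {..<n} \<times> {..<m}"
  by (simp add: cartesian_product_def complete_graph_def)

lemma edges_rook_iff:
  "{(a, i), (b, j)} \<in> edges (rook n m) \<longleftrightarrow>
     a < n \<and> b < n \<and> i < m \<and> j < m \<and> (a = b \<and> i \<noteq> j \<or> i = j \<and> a \<noteq> b)"
  by (auto simp: cartesian_product_def complete_graph_def doubleton_eq_iff card_insert_if)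

lemma simple_graph_rook: "simple_graph (rook n m)"
  by (intro simple_graph_cartesian_product simple_graph_complete_graph)

lemma swap_edges_rook: "(`) prod.swap ` edges (rook n m) \<subseteq> edges (rook m n)"
proof
  fix e assume "e \<in> (`) prod.swap ` edges (rook n m)"
  then obtain e' where e': "e' \<in> edges (rook n m)" "e = prod.swap ` e'"
    by blast
  then have "card e' = 2"
    using simple_graph_rook by (auto simp: simple_graph_def)
  then obtain a i b j where "e' = {(a, i), (b, j)}"
    by (auto simp: card_2_iff)
  then show "e \<in> edges (rook m n)"
    using e' by (auto simp: edges_rook_iff)
qed

text \<open>Swapping is an involution, so \<open>swap_edges_rook\<close> with \<open>n\<close> and
  \<open>m\<close> exchanged yields the reverse inclusion.\<close>

lemma swap_rook:
  "\<lparr>verts = prod.swap ` verts (rook n m), edges = (`) prod.swap ` edges (rook n m)\<rparr> = rook m n"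
proof -
  have "edges (rook m n) \<subseteq> (`) prod.swap ` edges (rook n m)"
  proof
    fix e assume "e \<in> edges (rook m n)"
    then have "prod.swap ` e \<in> edges (rook n m)"
      using swap_edges_rook[of m n] by blast
    moreover have "e = prod.swap ` prod.swap ` e"
      by (simp add: image_comp)
    ultimately show "e \<in> (`) prod.swap ` edges (rook n m)"
      by blast
  qed
  then have "(`) prod.swap ` edges (rook n m) = edges (rook m n)"
    using swap_edges_rook[of n m] by blast
  moreover have "prod.swap ` verts (rook n m) = verts (rook m n)"
    by (simp add: product_swap)
  ultimately show ?thesis
    by simp
qed

text \<open>
  With \<open>k \<ge> m\<close> parts left, the vertices in the last columns have been merged into column
  \<open>0\<close> along their rows; afterwards the remaining single column is collapsed.
\<close>

definition merge_map :: "nat \<Rightarrow> nat \<Rightarrow> nat \<times> nat \<Rightarrow> nat \<times> nat" where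
  "merge_map m k = (\<lambda>(c, i).
     if m \<le> k then (if c * m + i < k then (c, i) else (0, i))
     else (0, if i < k then i else 0))"

text \<open>The positions \<open>c * m + i\<close> number the vertices column by column. Going from
  \<open>Suc k\<close> to \<open>k\<close> moves only the vertex at position \<open>k\<close> if
  \<open>m \<le> k\<close>, into column \<open>0\<close> of its row; for \<open>k < m\<close> the
  part \<open>(0, k)\<close> is merged into \<open>(0, 0)\<close>.\<close>

lemma merge_map_step:
  assumes m: "m \<ge> 1" and k: "1 \<le> k" "k < n * m"
  shows "\<exists>u\<in>merge_map m (Suc k) ` verts (rook n m). \<exists>v\<in>merge_map m (Suc k) ` verts (rook n m).
           u \<noteq> v \<and> (\<forall>z\<in>verts (rook n m).
             merge_map m k z = (if merge_map m (Suc k) z = v then u else merge_map m (Suc k) z))"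
proof (cases "m \<le> k")
  case True
  \<comment> \<open>The vertex at position \<open>k\<close> is \<open>(q, t)\<close>. Since
    \<open>m \<le> k\<close>, its column \<open>q\<close> is not \<open>0\<close>, so its target
    \<open>(0, t)\<close> is a different part.\<close>
  define q t where "q = k div m" and "t = k mod m"
  have qt: "q * m + t = k" "t < m" "1 \<le> q" "q < n"
    using m k True by (auto simp: q_def t_def div_greater_zero_iff Suc_le_eq less_mult_imp_div_less)
  have uniq: "c * m + i = k \<longleftrightarrow> c = q \<and> i = t" if "i < m" for c i
    using that qt by (auto simp: q_def t_def)
  have "(0, t) = merge_map m (Suc k) (0, t)" "(q, t) = merge_map m (Suc k) (q, t)"
    using qt True by (auto simp: merge_map_def)
  then have "(0, t) \<in> merge_map m (Suc k) ` verts (rook n m)"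
    "(q, t) \<in> merge_map m (Suc k) ` verts (rook n m)"
    using qt by (force simp: image_iff)+
  moreover have "\<forall>z\<in>verts (rook n m).
      merge_map m k z = (if merge_map m (Suc k) z = (q, t) then (0, t) else merge_map m (Suc k) z)"
  proof
    fix z assume "z \<in> verts (rook n m)"
    then obtain c i where z: "z = (c, i)" "i < m"
      by auto
    show "merge_map m k z = (if merge_map m (Suc k) z = (q, t) then (0, t) else merge_map m (Suc k) z)"
      using True qt(3) uniq[OF z(2), of c] z(1)
      by (cases "c * m + i = k") (auto simp: merge_map_def less_Suc_eq)
  qed
  moreover have "(0, t) \<noteq> (q, t)"
    using qt by simp
  ultimately show ?thesis
    by blast
next
  case False
  have n: "0 < n"
    using k by (cases n) auto
  have "(0, 0) = merge_map m (Suc k) (0, 0)" "(0, k) = merge_map m (Suc k) (0, k)"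
    using False by (auto simp: merge_map_def)
  then have "(0, 0) \<in> merge_map m (Suc k) ` verts (rook n m)"
    "(0, k) \<in> merge_map m (Suc k) ` verts (rook n m)"
    using False n by (force simp: image_iff)+
  moreover have "\<forall>z\<in>verts (rook n m).
      merge_map m k z = (if merge_map m (Suc k) z = (0, k) then (0, 0) else merge_map m (Suc k) z)"
  proof
    fix z assume "z \<in> verts (rook n m)"
    then obtain c i where z: "z = (c, i)" "i < m"
      by auto
    \<comment> \<open>If \<open>Suc k = m\<close>, the map at \<open>Suc k\<close> still follows the
      first branch of \<open>merge_map\<close>. Only column \<open>0\<close> has positions below
      \<open>m\<close>, so everything lies in column \<open>0\<close> there too.\<close>
    have "c = 0" if "c * m + i < Suc k"
      using that False by (cases c) auto
    then show "merge_map m k z = (if merge_map m (Suc k) z = (0, k) then (0, 0) else merge_map m (Suc k) z)"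
      using False k z by (auto simp: merge_map_def)
  qed
  moreover have "(0, 0) \<noteq> (0::nat, k)"
    using k by simp
  ultimately show ?thesis
    by blast
qed

text \<open>
  Parts in a common row are completely joined, and a column other than \<open>0\<close> and the one being
  merged is untouched. So mixed pairs live in two columns and in distinct rows.
\<close>

lemma mixed_merge_mapD:
  assumes k: "m \<le> k" and mix: "mixed (rook n m) (merge_map m k) (a, i) (b, j)"
  shows "i \<noteq> j" "b \<in> {0, k div m}" "j < m"
proof -
  let ?h = "merge_map m k"
  have row: "snd (?h z) = snd z" for z
    using k by (cases z) (auto simp: merge_map_def)
  have hfst: "fst (?h (c, l)) = (if c * m + l < k then c else 0)" for c l
    using k by (auto simp: merge_map_def)
  \<comment> \<open>A mixed pair has an adjacent pair \<open>v\<close>, \<open>w\<close> and a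
    non-adjacent pair \<open>v'\<close>, \<open>w'\<close> of representatives.\<close>
  obtain v w where vw: "v \<in> verts (rook n m)" "w \<in> verts (rook n m)" "?h v = (a, i)" "?h w = (b, j)"
    "{v, w} \<in> edges (rook n m)"
    using mix by (auto simp: mixed_def some_between_def)
  obtain v' w' where vw': "v' \<in> verts (rook n m)" "w' \<in> verts (rook n m)" "?h v' = (a, i)" "?h w' = (b, j)"
    "{v', w'} \<notin> edges (rook n m)"
    using mix by (auto simp: mixed_def full_between_def)
  obtain c c' where c: "v = (c, i)" "v' = (c', i)"
    using vw(3) vw'(3) row[of v] row[of v'] by (metis prod.collapse snd_conv)
  obtain e e' where e: "w = (e, j)" "w' = (e', j)"
    using vw(4) vw'(4) row[of w] row[of w'] by (metis prod.collapse snd_conv)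
  have ne: "(a, i) \<noteq> (b, j)"
    using mix by (simp add: mixed_def)
  show ij: "i \<noteq> j"
  proof
    assume "i = j"
    then have "c' \<noteq> e'"
      using ne vw' c e by auto
    then show False
      using vw' c e \<open>i = j\<close> by (auto simp: edges_rook_iff)
  qed
  show "j < m"
    using vw e by simp
  \<comment> \<open>Across distinct rows, being adjacent means lying in the same column.\<close>
  have ce: "c = e"
    using vw c e ij by (simp add: edges_rook_iff)
  have ce': "c' \<noteq> e'"
    using vw' c e ij by (auto simp: edges_rook_iff)
  have A: "a = (if c * m + i < k then c else 0)" "a = (if c' * m + i < k then c' else 0)"
    using hfst[of c i] hfst[of c' i] vw vw' c by auto
  have B: "b = (if c * m + j < k then c else 0)" "b = (if e' * m + j < k then e' else 0)"
    using hfst[of c j] hfst[of e' j] vw vw' e ce by auto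
  have im: "i < m"
    using vw c by simp
  show "b \<in> {0, k div m}"
  proof (rule ccontr)
    \<comment> \<open>Then column \<open>b\<close> lies wholly below position \<open>k\<close> and
      is unmerged. This forces \<open>c = a = c'\<close>, while \<open>c = b = e'\<close>, contrary
      to \<open>c' \<noteq> e'\<close>.\<close>
    assume b: "b \<notin> {0, k div m}"
    then have bc: "b = c" "b = e'" "c * m + j < k"
      using B by (auto split: if_splits)
    have "b * m \<le> k"
      using bc by simp
    then have "b \<le> k div m"
      using im by (simp add: less_eq_div_iff_mult_less_eq)
    then have "b < k div m"
      using b by simp
    then have "Suc b \<le> k div m"
      by simp
    then have "Suc b * m \<le> k"
      using im by (simp add: less_eq_div_iff_mult_less_eq)
    then have "c * m + i < k"
      using im bc by simp
    then have "a = c" "a = c'"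
      using A b bc by (auto split: if_splits)
    then show False
      using ce' bc by simp
  qed
qed

text \<open>For \<open>m \<le> k\<close> the mixed partners lie in two columns and avoid the row of
  \<open>x\<close>. For \<open>k < m\<close> only \<open>k \<le> m - 1\<close> names in column
  \<open>0\<close> are left, so a crude count suffices.\<close>

lemma card_mixed_merge_map:
  assumes m: "m \<ge> 1" and k: "1 \<le> k" and x: "x \<in> merge_map m k ` verts (rook n m)"
  shows "card {y. mixed (rook n m) (merge_map m k) x y} \<le> 2 * (m - 1)"
proof -
  obtain a i where ai: "x = (a, i)"
    by (cases x)
  have im: "i < m"
    using x m ai by (auto simp: merge_map_def split: if_splits)
  show ?thesis
  proof (cases "m \<le> k")
    case True
    have "{y. mixed (rook n m) (merge_map m k) x y} \<subseteq> {0, k div m} \<times> ({..<m} - {i})"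
      using mixed_merge_mapD[OF True] ai by fastforce
    then have "card {y. mixed (rook n m) (merge_map m k) x y} \<le> card ({0, k div m} \<times> ({..<m} - {i}))"
      by (intro card_mono) auto
    also have "\<dots> \<le> 2 * (m - 1)"
      using im by (simp add: card_cartesian_product card_insert_if)
    finally show ?thesis .
  next
    case False
    have "y \<in> {0} \<times> ({..<k} - {i})" if "mixed (rook n m) (merge_map m k) x y" for y
    proof -
      have "x \<noteq> y" "y \<in> merge_map m k ` verts (rook n m)"
        using that mixed_image[OF that] by (auto simp: mixed_def)
      then show ?thesis
        using False k x ai by (auto simp: merge_map_def split: if_splits)
    qed
    then have "card {y. mixed (rook n m) (merge_map m k) x y} \<le> card ({0::nat} \<times> ({..<k} - {i}))"
      by (intro card_mono) auto
    also have "\<dots> \<le> k"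
      by (simp add: card_cartesian_product card_Diff_singleton_if)
    also have "\<dots> \<le> 2 * (m - 1)"
      using False by simp
    finally show ?thesis .
  qed
qed

lemma d_sequence_rook_image:
  fixes \<sigma> :: "nat \<times> nat \<Rightarrow> 'a"
  assumes n: "n \<ge> 1" and m: "m \<ge> 1" and \<sigma>: "inj \<sigma>"
  shows "\<exists>S. d_sequence (2 * (m - 1))
           \<lparr>verts = \<sigma> ` verts (rook n m), edges = (`) \<sigma> ` edges (rook n m)\<rparr> S"
proof (rule d_sequence_of_maps[where h = "merge_map m" and r = "(0, 0)"])
  have N: "card (verts (rook n m)) = n * m"
    by (simp add: card_cartesian_product)
  show "merge_map m (card (verts (rook n m))) z = z" if "z \<in> verts (rook n m)" for z
  proof -
    obtain c i where z: "z = (c, i)" "c < n" "i < m"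
      using \<open>z \<in> verts (rook n m)\<close> by auto
    \<comment> \<open>All positions lie below \<open>n * m\<close>, so the initial map moves no
      vertex.\<close>
    have "c * m + i < Suc c * m"
      using z by simp
    also have "\<dots> \<le> n * m"
      using z by (intro mult_le_mono) auto
    finally show ?thesis
      unfolding N using z n by (auto simp: merge_map_def)
  qed
  show "merge_map m 1 z = (0, 0)" if "z \<in> verts (rook n m)" for z
    using that m by (cases z) (auto simp: merge_map_def)
  show "verts (rook n m) \<noteq> {}"
    using n m by (auto intro!: exI[of _ 0] simp: lessThan_empty_iff)
  show "card {y. mixed (rook n m) (merge_map m k) x y} \<le> 2 * (m - 1)"
    if "1 \<le> k" "x \<in> merge_map m k ` verts (rook n m)" for k x
    using card_mixed_merge_map[OF m] that by blast
  show "\<exists>u\<in>merge_map m (Suc k) ` verts (rook n m). \<exists>v\<in>merge_map m (Suc k) ` verts (rook n m).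
           u \<noteq> v \<and> (\<forall>z\<in>verts (rook n m).
             merge_map m k z = (if merge_map m (Suc k) z = v then u else merge_map m (Suc k) z))"
    if "1 \<le> k" "k < card (verts (rook n m))" for k
    using merge_map_step[OF m] that unfolding N by blast
qed (use simple_graph_rook \<sigma> in auto)

lemma image_graph_id: "\<lparr>verts = id ` verts G, edges = (`) id ` edges G\<rparr> = (G :: 'a graph)"
  by simp

text \<open>\<open>d_sequence_rook_image\<close> gives a bound in the second factor; if the first is
  the smaller one, it is applied to the transposed product and swapped back.\<close>

lemma d_sequence_rook:
  assumes "n \<ge> 1" "m \<ge> 1"
  shows "\<exists>S. d_sequence (2 * (min n m - 1)) (rook n m) S"
proof (cases "n \<le> m")
  case True
  then show ?thesis
    using d_sequence_rook_image[OF assms(2,1), of prod.swap] unfolding swap_rook by simp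
next
  case False
  then show ?thesis
    using d_sequence_rook_image[OF assms, of id] unfolding image_graph_id by simp
qed

lemma tww_le: "d_sequence d G S \<Longrightarrow> tww G \<le> d"
  unfolding tww_def by (blast intro: Least_le)

text \<open>In this 4-cycle, antipodal vertices are twins.\<close>

lemma tww_rook_2_2: "tww (rook 2 2) = 0"
proof -
  \<comment> \<open>The two antipodal pairs are merged first, then the two resulting parts.
    \<open>merge_map\<close> would start with two adjacent vertices and create red edges.\<close>
  define h :: "nat \<Rightarrow> nat \<times> nat \<Rightarrow> nat \<times> nat" where
    "h = (\<lambda>k z. if k = 1 then (0, 0) else if k \<le> 3 \<and> z = (1, 1) then (0, 0)
       else if k \<le> 2 \<and> z = (1, 0) then (0, 1) else z)"
  have V: "verts (rook 2 2) = {(0, 0), (0, 1), (1, 0), (1, 1)}"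
    by (auto simp: less_2_cases_iff)
  have N: "card (verts (rook 2 2)) = 4"
    by (simp add: card_cartesian_product)
  have "\<exists>S. d_sequence 0 \<lparr>verts = id ` verts (rook 2 2), edges = (`) id ` edges (rook 2 2)\<rparr> S"
  proof (rule d_sequence_of_maps[where h = h and r = "(0, 0)"])
    show "h (card (verts (rook 2 2))) z = z" for z
      unfolding N by (simp add: h_def)
    show "h 1 z = (0, 0)" for z
      by (simp add: h_def)
    show "\<exists>u\<in>h (Suc k) ` verts (rook 2 2). \<exists>v\<in>h (Suc k) ` verts (rook 2 2). u \<noteq> v \<and>
             (\<forall>z\<in>verts (rook 2 2). h k z = (if h (Suc k) z = v then u else h (Suc k) z))"
      if k: "1 \<le> k" "k < card (verts (rook 2 2))" for k
    proof -
      consider "k = 1" | "k = 2" | "k = 3"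
        using k unfolding N by linarith
      then show ?thesis
        unfolding V by cases (auto simp: h_def)
    qed
    show "card {y. mixed (rook 2 2) (h k) x y} \<le> 0"
      if k: "1 \<le> k" "k \<le> card (verts (rook 2 2))" for k x
    proof -
      have "\<not> mixed (rook 2 2) (h k) x y" for y
      proof -
        consider "k = 1" | "k = 2" | "k = 3" | "k = 4"
          using k unfolding N by linarith
        then show ?thesis
          unfolding mixed_def full_between_def some_between_def V
          by cases (auto simp: h_def edges_rook_iff)
      qed
      then show ?thesis
        by simp
    qed
  qed (use simple_graph_rook V in auto)
  then show ?thesis
    unfolding image_graph_id using tww_le by blast
qed

section \<open>The lower bound from the first contraction\<close>

text \<open>After one contraction the red edges at the merged vertex lead to the vertices that
  distinguish \<open>u\<close> from \<open>v\<close>. The sequence in \<open>seq\<close> guarantees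
  that the minimum defining \<open>tww\<close> is attained.\<close>

lemma le_tww_first_contraction:
  fixes G :: "'a graph"
  assumes G: "simple_graph G" and two: "card (verts G) \<ge> 2"
    and seq: "d_sequence d G S'"
    and sd: "\<And>u v. u \<in> verts G \<Longrightarrow> v \<in> verts G \<Longrightarrow> u \<noteq> v \<Longrightarrow>
      D \<le> card {x. x \<noteq> u \<and> x \<noteq> v \<and> ({u, x} \<in> edges G \<longleftrightarrow> {v, x} \<notin> edges G)}"
  shows "D \<le> tww G"
proof -
  obtain S where S: "d_sequence (tww G) G S"
    using LeastI[of "\<lambda>d. \<exists>S. d_sequence d G S" d] seq unfolding tww_def by blast
  let ?N = "card (verts G)" and ?T = "trigraph_of G"
  have "contracts_to ?T (S (?N - 1))" and dt: "d_trigraph (tww G) (S (?N - 1))"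
    using S two unfolding d_sequence_def by (metis atLeastAtMost_iff order_refl, auto)
  then obtain u v w where uvw: "u \<in> verts G" "v \<in> verts G" "u \<noteq> v" "w \<notin> verts G - {u, v}"
    and SN: "S (?N - 1) = contract ?T u v w"
    by (auto simp: contracts_to_def trigraph_of_def)
  let ?D = "{x. x \<noteq> u \<and> x \<noteq> v \<and> ({u, x} \<in> edges G \<longleftrightarrow> {v, x} \<notin> edges G)}"
  have V: "x \<in> verts G" if "{a, x} \<in> edges G" for a x
    using G that by (auto simp: simple_graph_def)
  \<comment> \<open>The original graph has no red edges, so every red edge is new and contains
    \<open>w\<close>.\<close>
  have "red (contract ?T u v w) = (\<lambda>x. {w, x}) ` ?D"
    by (auto simp: contract_def Let_def nbrs_def trigraph_of_def)
  \<comment> \<open>Even if \<open>w\<close> reuses the name \<open>u\<close> or \<open>v\<close>,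
    it differs from all vertices in \<open>?D\<close>.\<close>
  moreover have "inj_on (\<lambda>x. {w, x}) ?D"
    using V uvw(4) by (auto simp: inj_on_def doubleton_eq_iff)
  ultimately have "card {e \<in> red (contract ?T u v w). w \<in> e} = card ?D"
    by (subst card_image[symmetric, of "\<lambda>x. {w, x}"]) (auto intro!: arg_cong[of _ _ card])
  moreover have "w \<in> tverts (contract ?T u v w)"
    by (simp add: contract_def Let_def)
  ultimately have "card ?D \<le> tww G"
    using dt SN by (auto simp: d_trigraph_def)
  then show ?thesis
    using sd[OF uvw(1-3)] by linarith
qed

text \<open>Two vertices in a common line are distinguished by the rest of the two lines crossing it
  there. Otherwise the distinguishing vertices found are those on the two rows and two columns,
  without the four crossing points.\<close>

lemma rook_symdiff_card:
  assumes n: "n \<ge> 2" and m: "m \<ge> 2" and nm: "n \<ge> 3 \<or> m \<ge> 3"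
    and u: "u \<in> verts (rook n m)" and v: "v \<in> verts (rook n m)" and uv: "u \<noteq> v"
  shows "2 * (min n m - 1) \<le> card {x. x \<noteq> u \<and> x \<noteq> v \<and>
           ({u, x} \<in> edges (rook n m) \<longleftrightarrow> {v, x} \<notin> edges (rook n m))}"
    (is "_ \<le> card ?D")
proof -
  obtain a i b j where ab: "u = (a, i)" "v = (b, j)"
    by (cases u; cases v)
  have lt: "a < n" "b < n" "i < m" "j < m"
    using u v ab by auto
  have "?D \<subseteq> {..<n} \<times> {..<m}"
    using ab by (auto simp: edges_rook_iff)
  then have fin: "finite ?D"
    by (rule finite_subset) simp
  consider "a = b" "i \<noteq> j" | "a \<noteq> b" "i = j" | "a \<noteq> b" "i \<noteq> j"
    using uv ab by auto
  then show ?thesis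
  proof cases
    case 1
    have "({..<n} - {a}) \<times> {i, j} \<subseteq> ?D"
      using 1 lt ab by (auto simp: edges_rook_iff)
    then have "card (({..<n} - {a}) \<times> {i, j}) \<le> card ?D"
      using fin by (rule card_mono[rotated])
    then show ?thesis
      using 1 lt by (simp add: card_cartesian_product)
  next
    case 2
    have "{a, b} \<times> ({..<m} - {i}) \<subseteq> ?D"
      using 2 lt ab by (auto simp: edges_rook_iff)
    then have "card ({a, b} \<times> ({..<m} - {i})) \<le> card ?D"
      using fin by (rule card_mono[rotated])
    then show ?thesis
      using 2 lt by (simp add: card_cartesian_product)
  next
    case 3
    \<comment> \<open>The crossings \<open>(a, j)\<close> and \<open>(b, i)\<close> are common
      neighbours and do not count.\<close>
    have "{a, b} \<times> ({..<m} - {i, j}) \<union> ({..<n} - {a, b}) \<times> {i, j} \<subseteq> ?D"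
      using 3 lt ab by (auto simp: edges_rook_iff)
    then have "card ({a, b} \<times> ({..<m} - {i, j}) \<union> ({..<n} - {a, b}) \<times> {i, j}) \<le> card ?D"
      using fin by (rule card_mono[rotated])
    moreover have "card ({a, b} \<times> ({..<m} - {i, j}) \<union> ({..<n} - {a, b}) \<times> {i, j})
        = card ({a, b} \<times> ({..<m} - {i, j})) + card (({..<n} - {a, b}) \<times> {i, j})"
      by (intro card_Un_disjoint) auto
    moreover have "card ({..<m} - {i, j}) = m - 2" "card ({..<n} - {a, b}) = n - 2"
      using 3 lt by (simp_all add: card_Diff_subset)
    ultimately have "2 * (m - 2) + 2 * (n - 2) \<le> card ?D"
      using 3 by (simp add: card_cartesian_product)
    then show ?thesis
      \<comment> \<open>\<open>n + m - 4 \<ge> min n m - 1\<close> amounts to the larger side being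
        at least \<open>3\<close>; this is where the 4-cycle is excluded.\<close>
      using n m nm by linarith
  qed
qed

theorem proposition3p2:
  fixes n m :: nat
  assumes "n \<ge> 1" and "m \<ge> 1"
  shows "tww (cartesian_product (complete_graph n) (complete_graph m)) =
           (if (n = 2 \<and> m = 2) \<or> min n m = 1 then 0 else 2 * (min n m - 1))"
proof -
  obtain S where S: "d_sequence (2 * (min n m - 1)) (rook n m) S"
    using d_sequence_rook[OF assms] by blast
  note upper = tww_le[OF S]
  consider "n = 2" "m = 2" | "min n m = 1" | "n \<ge> 2" "m \<ge> 2" "n \<ge> 3 \<or> m \<ge> 3"
    using assms by linarith
  then show ?thesis
  proof cases
    case 1
    then show ?thesis
      by (simp add: tww_rook_2_2)
  next
    case 2
    then show ?thesis
      using upper by simp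
  next
    case 3
    \<comment> \<open>At least two vertices are required for a first contraction to exist.\<close>
    have "2 * 1 \<le> n * m"
      using 3 by (intro mult_le_mono) auto
    then have "2 \<le> card (verts (rook n m))"
      by (simp add: card_cartesian_product)
    then have "2 * (min n m - 1) \<le> tww (rook n m)"
      using le_tww_first_contraction[OF simple_graph_rook _ S] rook_symdiff_card[OF 3] by blast
    then show ?thesis
      using upper 3 by auto
  qed
qed

end
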